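(* Let $X$ be a Tychonoff space which is a $\mu$-space and which admits a countable family $\mathcal{U}=\{U_i: i\in\omega\}$ of open subsets of $X$, a subset $A=\{a_i:i\in\omega\}\subseteq X$ and a point $z\in X$ such that (i) $a_i\in U_i$ for every $i\in\omega$; (ii) the set $\{i\in\omega: C\cap U_i\neq\emptyset\}$ is finite for each compact subset $C$ of $X$; (iii) $z$ is a cluster point of $A$. Then the free locally convex space $L(X)$ over $X$ is not a $c_0$-quasibarrelled space.
   Context: Locally convex spaces (lcs) are real and Hausdorff; Tychonoff means completely regular and Hausdorff; $\omega=\{0,1,2,\dots\}$. The free locally convex space over a Tychonoff space $X$ is an lcs $L(X)$ with a continuous map $i:X\to L(X)$ such that for every continuous map $f$ from $X$ to an lcs $E$ there is a unique continuous linear operator $\bar f:L(X)\to E$ with $f=\bar f\circ i$. It exists and is essentially unique, and $i$ is a topological embedding whose image is a Hamel basis of $L(X)$. A subset of $X$ is functionally bounded in $X$ if every continuous $f:X\to\mathbb{R}$ is bounded on it; $X$ is a $\mu$-space if every functionally bounded subset of $X$ has compact closure. For an lcs $E$ with dual $E'$, $\beta(E',E)$ is the strong topology (uniform convergence on bounded subsets of $E$). A subset of $E'$ is equicontinuous if it is contained in the polar $U^\circ=\{\chi\in E':|\chi(x)|\le 1\ \forall x\in U\}$ of some neighborhood $U$ of zero in $E$. $E$ is $c_0$-quasibarrelled if every $\beta(E',E)$-null sequence in $E'$ is equicontinuous. *)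

theory Defs
  imports "HOL-Analysis.Analysis" "HOL-Analysis.Finite_Function_Topology"
begin

definition tychonoff_space :: "'a topology \<Rightarrow> bool" where
  "tychonoff_space X \<longleftrightarrow> completely_regular_space X \<and> Hausdorff_space X"

definition functionally_bounded_in :: "'a topology \<Rightarrow> 'a set \<Rightarrow> bool" where
  "functionally_bounded_in X S \<longleftrightarrow>
     S \<subseteq> topspace X \<and> (\<forall>f. continuous_map X euclideanreal f \<longrightarrow> bounded (f ` S))"

definition mu_space :: "'a topology \<Rightarrow> bool" where
  "mu_space X \<longleftrightarrow> (\<forall>S. functionally_bounded_in X S \<longrightarrow> compactin X (X closure_of S))"


section \<open>Locally convex spaces\<close>

text \<open>
  A real Hausdorff locally convex space is given by a topology \<open>E\<close> whose carrier
  \<open>topspace E\<close> is a linear subspace of some real vector space type, with the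
  operations inherited from that type. The topology of the type itself, if it has one, plays no role.
\<close>

definition lc_space :: "'v::real_vector topology \<Rightarrow> bool" where
  "lc_space E \<longleftrightarrow>
     subspace (topspace E) \<and>
     continuous_map (prod_topology E E) E (\<lambda>(x, y). x + y) \<and>
     continuous_map (prod_topology euclideanreal E) E (\<lambda>(c, x). c *\<^sub>R x) \<and>
     neighbourhood_base_of convex E \<and>
     Hausdorff_space E"

text \<open>
  Continuous linear operators, normalised to be \<^const>\<open>undefined\<close> outside the carrier, so that
  equality in \<^term>\<open>lc_operators E F\<close> is equality of operators.
\<close>

definition lc_operators :: "'v::real_vector topology \<Rightarrow> 'w::real_vector topology \<Rightarrow> ('v \<Rightarrow> 'w) set" where
  "lc_operators E F =
     {g \<in> extensional (topspace E).
        (\<forall>x\<in>topspace E. \<forall>y\<in>topspace E. g (x + y) = g x + g y) \<and>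
        (\<forall>c. \<forall>x\<in>topspace E. g (c *\<^sub>R x) = c *\<^sub>R g x) \<and>
        continuous_map E F g}"

definition lc_dual :: "'v::real_vector topology \<Rightarrow> ('v \<Rightarrow> real) set" where
  "lc_dual E = lc_operators E euclideanreal"

definition zero_nbhd :: "'v::real_vector topology \<Rightarrow> 'v set \<Rightarrow> bool" where
  "zero_nbhd E U \<longleftrightarrow> U \<subseteq> topspace E \<and> (\<exists>V. openin E V \<and> 0 \<in> V \<and> V \<subseteq> U)"

definition lc_bounded :: "'v::real_vector topology \<Rightarrow> 'v set \<Rightarrow> bool" where
  "lc_bounded E B \<longleftrightarrow> B \<subseteq> topspace E \<and>
     (\<forall>U. zero_nbhd E U \<longrightarrow> (\<exists>r>0. \<forall>c. \<bar>c\<bar> \<ge> r \<longrightarrow> B \<subseteq> (\<lambda>x. c *\<^sub>R x) ` U))"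

definition polar :: "'v::real_vector topology \<Rightarrow> 'v set \<Rightarrow> ('v \<Rightarrow> real) set" where
  "polar E U = {\<phi> \<in> lc_dual E. \<forall>x\<in>U. \<bar>\<phi> x\<bar> \<le> 1}"

definition equicontinuous :: "'v::real_vector topology \<Rightarrow> ('v \<Rightarrow> real) set \<Rightarrow> bool" where
  "equicontinuous E H \<longleftrightarrow> (\<exists>U. zero_nbhd E U \<and> H \<subseteq> polar E U)"

definition strong_dual :: "'v::real_vector topology \<Rightarrow> ('v \<Rightarrow> real) topology" where
  "strong_dual E = topology (\<lambda>W. W \<subseteq> lc_dual E \<and>
     (\<forall>\<phi>\<in>W. \<exists>B \<epsilon>. lc_bounded E B \<and> \<epsilon> > 0 \<and>
        {\<psi> \<in> lc_dual E. \<forall>x\<in>B. \<bar>\<psi> x - \<phi> x\<bar> < \<epsilon>} \<subseteq> W))"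

definition c0_quasibarrelled :: "'v::real_vector topology \<Rightarrow> bool" where
  "c0_quasibarrelled E \<longleftrightarrow>
     (\<forall>\<phi> :: nat \<Rightarrow> 'v \<Rightarrow> real.
        (\<forall>n. \<phi> n \<in> lc_dual E) \<and> limitin (strong_dual E) \<phi> (\<lambda>x\<in>topspace E. 0) sequentially
        \<longrightarrow> equicontinuous E (range \<phi>))"

lemma lc_bounded_empty: "lc_bounded E {}"
  by (auto simp: lc_bounded_def intro: exI[of _ 1])

lemma lc_bounded_Un:
  assumes "lc_bounded E B" "lc_bounded E C"
  shows "lc_bounded E (B \<union> C)"
  unfolding lc_bounded_def
proof (intro conjI allI impI)
  show "B \<union> C \<subseteq> topspace E"
    using assms by (auto simp: lc_bounded_def)
  fix U assume U: "zero_nbhd E U"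
  obtain r s where rs: "r > 0" "\<And>c. \<bar>c\<bar> \<ge> r \<Longrightarrow> B \<subseteq> (\<lambda>x. c *\<^sub>R x) ` U"
      "s > 0" "\<And>c. \<bar>c\<bar> \<ge> s \<Longrightarrow> C \<subseteq> (\<lambda>x. c *\<^sub>R x) ` U"
    using assms U unfolding lc_bounded_def by meson
  show "\<exists>r>0. \<forall>c. \<bar>c\<bar> \<ge> r \<longrightarrow> B \<union> C \<subseteq> (\<lambda>x. c *\<^sub>R x) ` U"
    using rs by (intro exI[of _ "max r s"]) auto
qed

lemma openin_strong_dual:
  "openin (strong_dual E) W \<longleftrightarrow> W \<subseteq> lc_dual E \<and>
     (\<forall>\<phi>\<in>W. \<exists>B \<epsilon>. lc_bounded E B \<and> \<epsilon> > 0 \<and>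
        {\<psi> \<in> lc_dual E. \<forall>x\<in>B. \<bar>\<psi> x - \<phi> x\<bar> < \<epsilon>} \<subseteq> W)"
proof -
  let ?N = "\<lambda>\<phi> B \<epsilon>. {\<psi> \<in> lc_dual E. \<forall>x\<in>B. \<bar>\<psi> x - \<phi> x\<bar> < \<epsilon>}"
  have "istopology (\<lambda>W. W \<subseteq> lc_dual E \<and>
     (\<forall>\<phi>\<in>W. \<exists>B \<epsilon>. lc_bounded E B \<and> \<epsilon> > 0 \<and> ?N \<phi> B \<epsilon> \<subseteq> W))"
    unfolding istopology_def
  proof (intro conjI allI impI ballI)
    fix S T \<phi>
    assume S: "S \<subseteq> lc_dual E \<and> (\<forall>\<phi>\<in>S. \<exists>B \<epsilon>. lc_bounded E B \<and> \<epsilon> > 0 \<and> ?N \<phi> B \<epsilon> \<subseteq> S)"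
      and T: "T \<subseteq> lc_dual E \<and> (\<forall>\<phi>\<in>T. \<exists>B \<epsilon>. lc_bounded E B \<and> \<epsilon> > 0 \<and> ?N \<phi> B \<epsilon> \<subseteq> T)"
      and \<phi>: "\<phi> \<in> S \<inter> T"
    from S \<phi> obtain B \<epsilon> where 1: "lc_bounded E B" "\<epsilon> > 0" "?N \<phi> B \<epsilon> \<subseteq> S" by blast
    from T \<phi> obtain C \<delta> where 2: "lc_bounded E C" "\<delta> > 0" "?N \<phi> C \<delta> \<subseteq> T" by blast
    have "?N \<phi> (B \<union> C) (min \<epsilon> \<delta>) \<subseteq> ?N \<phi> B \<epsilon> \<inter> ?N \<phi> C \<delta>" by auto
    then have "?N \<phi> (B \<union> C) (min \<epsilon> \<delta>) \<subseteq> S \<inter> T" using 1 2 by blast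
    moreover have "min \<epsilon> \<delta> > 0" using 1 2 by simp
    ultimately show "\<exists>B \<epsilon>. lc_bounded E B \<and> \<epsilon> > 0 \<and> ?N \<phi> B \<epsilon> \<subseteq> S \<inter> T"
      using lc_bounded_Un[OF 1(1) 2(1)] by blast
  next
    fix K \<phi>
    assume K: "\<forall>S\<in>K. S \<subseteq> lc_dual E \<and> (\<forall>\<phi>\<in>S. \<exists>B \<epsilon>. lc_bounded E B \<and> \<epsilon> > 0 \<and> ?N \<phi> B \<epsilon> \<subseteq> S)"
      and \<phi>: "\<phi> \<in> \<Union>K"
    then obtain S where S: "S \<in> K" "\<phi> \<in> S" by blast
    then obtain B \<epsilon> where "lc_bounded E B" "\<epsilon> > 0" "?N \<phi> B \<epsilon> \<subseteq> S" using K by blast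
    then show "\<exists>B \<epsilon>. lc_bounded E B \<and> \<epsilon> > 0 \<and> ?N \<phi> B \<epsilon> \<subseteq> \<Union>K" using S by blast
  qed blast+
  then show ?thesis
    by (simp add: strong_dual_def)
qed

lemma topspace_strong_dual: "topspace (strong_dual E) = lc_dual E"
proof
  show "topspace (strong_dual E) \<subseteq> lc_dual E"
    using openin_strong_dual by blast
  have "openin (strong_dual E) (lc_dual E)"
    unfolding openin_strong_dual using lc_bounded_empty[of E] zero_less_one by blast
  then show "lc_dual E \<subseteq> topspace (strong_dual E)"
    by (rule openin_subset)
qed


section \<open>Free locally convex spaces\<close>

definition lc_universal_for ::
  "'a topology \<Rightarrow> 'v::real_vector topology \<Rightarrow> ('a \<Rightarrow> 'v) \<Rightarrow> 'e::real_vector topology \<Rightarrow> bool" where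
  "lc_universal_for X L i E \<longleftrightarrow>
     (\<forall>f. continuous_map X E f \<longrightarrow>
        (\<exists>!g. g \<in> lc_operators L E \<and> (\<forall>x\<in>topspace X. g (i x) = f x)))"

text \<open>
  The universal property ranges over all locally convex spaces \<open>E\<close>. Since types cannot be
  quantified inside a formula, the definition tests it on all spaces living in the type of \<open>L\<close>
  and on all spaces living in \<open>'a \<Rightarrow>\<^sub>0 real\<close>, the free vector space on the type of points.
  These are large enough: \<open>free_lc_space_universal\<close> below derives the universal property for
  spaces \<open>E\<close> of an arbitrary type.
\<close>

definition free_lc_space :: "'a topology \<Rightarrow> 'v::real_vector topology \<Rightarrow> ('a \<Rightarrow> 'v) \<Rightarrow> bool" where
  "free_lc_space X L i \<longleftrightarrow>
     lc_space L \<and> continuous_map X L i \<and>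
     (\<forall>E :: 'v topology. lc_space E \<longrightarrow> lc_universal_for X L i E) \<and>
     (\<forall>E :: ('a \<Rightarrow>\<^sub>0 real) topology. lc_space E \<longrightarrow> lc_universal_for X L i E)"

lemma lc_space_pullback:
  fixes G :: "'w::real_vector \<Rightarrow> 'e::real_vector"
  assumes E: "lc_space E" and G: "linear G" and A: "subspace A" "inj_on G A" "G ` A \<subseteq> topspace E"
  shows "lc_space (pullback_topology A G E)" (is "lc_space ?P")
proof -
  have top: "topspace ?P = A"
    using A by (auto simp: topspace_pullback_topology)
  have GP: "continuous_map ?P E G"
    using continuous_map_pullback[OF continuous_map_id, of A G E] by simp
  have "continuous_map (prod_topology ?P ?P) ?P (\<lambda>(x, y). x + y)"
  proof (rule continuous_map_pullback')
    have "continuous_map (prod_topology ?P ?P) (prod_topology E E) (\<lambda>(x, y). (G x, G y))"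
      using GP by (simp add: continuous_map_prod_top)
    from continuous_map_compose[OF this] E
    have "continuous_map (prod_topology ?P ?P) E ((\<lambda>(x, y). x + y) \<circ> (\<lambda>(x, y). (G x, G y)))"
      by (auto simp: lc_space_def)
    also have "(\<lambda>(x, y). x + y) \<circ> (\<lambda>(x, y). (G x, G y)) = G \<circ> (\<lambda>(x, y). x + y)"
      using G by (auto simp: linear_add)
    finally show "continuous_map (prod_topology ?P ?P) E (G \<circ> (\<lambda>(x, y). x + y))" .
  qed (use A top in \<open>auto intro: subspace_add\<close>)
  moreover have "continuous_map (prod_topology euclideanreal ?P) ?P (\<lambda>(c, x). c *\<^sub>R x)"
  proof (rule continuous_map_pullback')
    have "continuous_map (prod_topology euclideanreal ?P) (prod_topology euclideanreal E) (\<lambda>(c, y). (id c, G y))"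
      using GP by (subst continuous_map_prod_top) auto
    from continuous_map_compose[OF this] E
    have "continuous_map (prod_topology euclideanreal ?P) E ((\<lambda>(c, x). c *\<^sub>R x) \<circ> (\<lambda>(c, y). (id c, G y)))"
      by (auto simp: lc_space_def)
    also have "(\<lambda>(c, x). c *\<^sub>R x) \<circ> (\<lambda>(c, y). (id c, G y)) = G \<circ> (\<lambda>(c, x). c *\<^sub>R x)"
      using G by (auto simp: linear_scale)
    finally show "continuous_map (prod_topology euclideanreal ?P) E (G \<circ> (\<lambda>(c, x). c *\<^sub>R x))" .
  qed (use A top in \<open>auto intro: subspace_scale\<close>)
  moreover have "neighbourhood_base_of convex ?P"
    unfolding neighbourhood_base_of
  proof (intro allI impI)
    fix W x assume W: "openin ?P W \<and> x \<in> W"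
    then obtain U where U: "openin E U" "W = G -` U \<inter> A"
      by (auto simp: openin_pullback_topology)
    moreover have "neighbourhood_base_of convex E"
      using E by (simp add: lc_space_def)
    ultimately obtain U' V where V: "openin E U'" "convex V" "G x \<in> U'" "U' \<subseteq> V" "V \<subseteq> U"
      using W unfolding neighbourhood_base_of by (metis IntE vimageE)
    show "\<exists>U V. openin ?P U \<and> convex V \<and> x \<in> U \<and> U \<subseteq> V \<and> V \<subseteq> W"
    proof (intro exI conjI)
      show "openin ?P (G -` U' \<inter> A)"
        using V by (auto simp: openin_pullback_topology)
      show "convex (G -` V \<inter> A)"
        by (rule convex_Int[OF convex_linear_vimage[OF G V(2)] subspace_imp_convex[OF A(1)]])
    qed (use V U W in auto)
  qed
  moreover have "Hausdorff_space ?P"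
    unfolding Hausdorff_space_def
  proof (intro allI impI)
    fix x y assume xy: "x \<in> topspace ?P \<and> y \<in> topspace ?P \<and> x \<noteq> y"
    then have "G x \<noteq> G y" "G x \<in> topspace E" "G y \<in> topspace E"
      using A by (auto simp: top inj_on_def)
    then obtain U V where UV: "openin E U" "openin E V" "G x \<in> U" "G y \<in> V" "disjnt U V"
      using E by (metis lc_space_def Hausdorff_space_def)
    show "\<exists>U V. openin ?P U \<and> openin ?P V \<and> x \<in> U \<and> y \<in> V \<and> disjnt U V"
    proof (intro exI conjI)
      show "openin ?P (G -` U \<inter> A)" "openin ?P (G -` V \<inter> A)"
        using UV by (auto simp: openin_pullback_topology)
    qed (use UV xy top in \<open>auto simp: disjnt_def\<close>)
  qed
  ultimately show ?thesis
    using A top by (simp add: lc_space_def)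
qed

lemma free_lc_space_lift_exists:
  fixes X :: "'a topology" and L :: "'v::real_vector topology" and E :: "'e::real_vector topology"
  assumes free: "free_lc_space X L i" and E: "lc_space E" and f: "continuous_map X E f"
  shows "\<exists>g \<in> lc_operators L E. (\<forall>x\<in>topspace X. g (i x) = f x) \<and>
           g ` topspace L \<subseteq> span (f ` topspace X)"
proof -
  define S where "S = span (f ` topspace X)"
  have L: "subspace (topspace L)" using free by (simp add: free_lc_space_def lc_space_def)
  have SE: "S \<subseteq> topspace E"
    unfolding S_def using f E by (intro span_minimal) (auto simp: lc_space_def continuous_map_def)
  obtain B where B: "B \<subseteq> f ` topspace X" "independent B" "f ` topspace X \<subseteq> span B"
    using maximal_independent_subset by metis
  have SB: "S = span B"
    unfolding S_def using B by (intro span_eq[THEN iffD2]) (auto intro: span_base)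
  define c where "c b = inv_into (topspace X) f b" for b
  have c: "f (c b) = b" if "b \<in> B" for b
    using that B by (auto simp: c_def f_inv_into_f)
  define s where "s a = Poly_Mapping.single a (1::real)" for a :: 'a
  have lookup_scale: "Poly_Mapping.lookup (r *\<^sub>R p) a = r * Poly_Mapping.lookup p a"
    for r :: real and p :: "'a \<Rightarrow>\<^sub>0 real" and a
    by (simp add: scaleR_poly_mapping_def)
  have "independent (range s)"
  proof
    assume "dependent (range s)"
    then obtain T u a where T: "finite T" "T \<subseteq> range s" and a: "s a \<in> T" "u (s a) \<noteq> 0"
      and sum0: "(\<Sum>v\<in>T. u v *\<^sub>R v) = 0"
      unfolding dependent_explicit by blast
    have "0 = (\<Sum>v\<in>T. u v * Poly_Mapping.lookup v a)"
      using arg_cong[OF sum0, of "\<lambda>p. Poly_Mapping.lookup p a"] by (simp add: lookup_sum lookup_scale)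
    also have "\<dots> = (\<Sum>v\<in>T. if v = s a then u v else 0)"
    proof (rule sum.cong[OF refl])
      fix v assume "v \<in> T"
      then obtain b where "v = s b" using T by auto
      moreover have "s b = s a \<longleftrightarrow> b = a"
        by (metis s_def lookup_single_eq lookup_single_not_eq zero_neq_one)
      ultimately show "u v * Poly_Mapping.lookup v a = (if v = s a then u v else 0)"
        by (auto simp: s_def lookup_single when_def)
    qed
    also have "\<dots> = u (s a)" using T a by simp
    finally show False using a by simp
  qed
  then have ind: "independent ((\<lambda>b. s (c b)) ` B)"
    by (rule independent_mono) auto
  have inj: "inj_on (\<lambda>b. s (c b)) B"
  proof (rule inj_onI)
    fix b b' assume b: "b \<in> B" "b' \<in> B" and "s (c b) = s (c b')"
    then have "c b = c b'"
      by (metis s_def lookup_single_eq lookup_single_not_eq zero_neq_one)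
    then show "b = b'" using c b by metis
  qed
  obtain J where J: "linear J" "\<And>b. b \<in> B \<Longrightarrow> J b = s (c b)"
    using linear_independent_extend[OF B(2), of "\<lambda>b. s (c b)"] by blast
  have "J ` B = (\<lambda>b. s (c b)) ` B" "inj_on J B"
    using J(2) inj by (auto cong: inj_on_cong image_cong)
  then have "inj_on J S"
    unfolding SB using linear_inj_on_span_independent_image[OF J(1)] ind by simp
  then obtain G where G: "range G \<subseteq> S" "linear G" "\<And>v. v \<in> S \<Longrightarrow> G (J v) = v"
    using linear_exists_left_inverse_on[OF J(1), of S] by (auto simp: S_def)
  define P where "P = pullback_topology (J ` S) G E"
  have P: "lc_space P"
    unfolding P_def
  proof (rule lc_space_pullback[OF E G(2)])
    show "subspace (J ` S)" using J(1) by (simp add: S_def linear_subspace_image)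
    show "inj_on G (J ` S)" using G(3) by (intro inj_onI) auto
    show "G ` J ` S \<subseteq> topspace E" using SE G(3) by auto
  qed
  have fS: "f x \<in> S" if "x \<in> topspace X" for x
    using that by (simp add: S_def span_base)
  have "continuous_map X P (\<lambda>x. J (f x))"
    unfolding P_def
  proof (rule continuous_map_pullback')
    show "continuous_map X E (G \<circ> (\<lambda>x. J (f x)))"
      by (rule continuous_map_eq[OF f]) (simp add: G(3) fS)
  qed (use fS in auto)
  moreover have "lc_universal_for X L i P"
    using free P by (simp add: free_lc_space_def)
  ultimately obtain h where h: "h \<in> lc_operators L P" "\<And>x. x \<in> topspace X \<Longrightarrow> h (i x) = J (f x)"
    unfolding lc_universal_for_def by blast
  have ix: "i x \<in> topspace L" if "x \<in> topspace X" for x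
    using that free by (auto simp: free_lc_space_def continuous_map_def)
  have "continuous_map P E G"
    unfolding P_def using continuous_map_pullback[OF continuous_map_id, of "J ` S" G E] by simp
  then have "continuous_map L E (G \<circ> h)"
    using h(1) by (intro continuous_map_compose) (auto simp: lc_operators_def)
  then have "continuous_map L E (restrict (G \<circ> h) (topspace L))"
    by (rule continuous_map_eq) simp
  then have "restrict (G \<circ> h) (topspace L) \<in> lc_operators L E"
    using h(1) L G(2)
    by (auto simp: lc_operators_def linear_add linear_scale subspace_add subspace_scale)
  moreover have "\<forall>x\<in>topspace X. restrict (G \<circ> h) (topspace L) (i x) = f x"
    using h(2) ix G(3) fS by simp
  moreover have "restrict (G \<circ> h) (topspace L) ` topspace L \<subseteq> S"
    using G(1) by auto
  ultimately show ?thesis unfolding S_def by blast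
qed

lemma free_lc_space_span:
  assumes free: "free_lc_space X L i"
  shows "topspace L = span (i ` topspace X)"
proof
  have L: "lc_space L" "continuous_map X L i" "lc_universal_for X L i L"
    using free by (auto simp: free_lc_space_def)
  show "span (i ` topspace X) \<subseteq> topspace L"
    using L by (intro span_minimal) (auto simp: lc_space_def continuous_map_def)
  obtain g where g: "g \<in> lc_operators L L" "\<forall>x\<in>topspace X. g (i x) = i x"
      "g ` topspace L \<subseteq> span (i ` topspace X)"
    using free_lc_space_lift_exists[OF free L(1,2)] by blast
  have "continuous_map L L (restrict id (topspace L))"
    by (rule continuous_map_eq[OF continuous_map_id]) simp
  then have "restrict id (topspace L) \<in> lc_operators L L"
    using L(1) by (auto simp: lc_operators_def lc_space_def subspace_add subspace_scale)
  moreover have "\<forall>x\<in>topspace X. restrict id (topspace L) (i x) = i x"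
    using L(2) by (auto simp: continuous_map_def)
  ultimately have "g = restrict id (topspace L)"
    using L(2,3) g(1,2) unfolding lc_universal_for_def by blast
  then show "topspace L \<subseteq> span (i ` topspace X)" using g(3) by auto
qed

theorem free_lc_space_universal:
  fixes E :: "'e::real_vector topology"
  assumes free: "free_lc_space X L i" and E: "lc_space E"
  shows "lc_universal_for X L i E"
  unfolding lc_universal_for_def
proof (intro allI impI ex_ex1I)
  fix f assume "continuous_map X E f"
  then show "\<exists>g. g \<in> lc_operators L E \<and> (\<forall>x\<in>topspace X. g (i x) = f x)"
    using free_lc_space_lift_exists[OF free E] by blast
next
  fix f g h
  assume g: "g \<in> lc_operators L E \<and> (\<forall>x\<in>topspace X. g (i x) = f x)"
    and h: "h \<in> lc_operators L E \<and> (\<forall>x\<in>topspace X. h (i x) = f x)"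
  have L: "subspace (topspace L)" and i: "\<And>x. x \<in> topspace X \<Longrightarrow> i x \<in> topspace L"
    using free by (auto simp: free_lc_space_def lc_space_def continuous_map_def)
  have scale: "k (c *\<^sub>R x) = c *\<^sub>R k x" and add: "k (x + y) = k x + k y"
    if "k \<in> lc_operators L E" "x \<in> topspace L" "y \<in> topspace L" for k c x y
    using that by (auto simp: lc_operators_def)
  have zero: "k 0 = 0" if "k \<in> lc_operators L E" for k
    using scale[of k 0 0 0] that subspace_0[OF L] by simp
  have "subspace {v \<in> topspace L. g v = h v}"
    using L g h by (auto simp: subspace_def zero scale add)
  then have "span (i ` topspace X) \<subseteq> {v \<in> topspace L. g v = h v}"
    using g h i by (intro span_minimal) auto
  then have "\<forall>v\<in>topspace L. g v = h v"
    using free_lc_space_span[OF free] by auto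
  moreover have "g \<in> extensional (topspace L)" "h \<in> extensional (topspace L)"
    using g h by (auto simp: lc_operators_def)
  ultimately show "g = h"
    by (auto intro: extensionalityI)
qed

end

theory Submission
  imports Defs
begin

text \<open>
  Why the theorem holds. By complete regularity choose continuous real functions \<open>h n\<close>
  with value \<open>1\<close> at \<open>a n\<close> that vanish outside \<open>U n\<close>, and extend them to continuous linear
  functionals \<open>\<phi> n\<close> on \<open>L(X)\<close>. This sequence violates the defining property of a
  \<open>c\<^sub>0\<close>-quasibarrelled space.

  It is strongly null: the points of \<open>X\<close> occurring in the elements of a bounded subset \<open>B\<close> of
  \<open>L(X)\<close> form a functionally bounded set (\<open>functionally_bounded_support\<close>, a gliding hump argument),
  so in a \<open>\<mu>\<close>-space they lie in a compact set \<open>C\<close>. Only finitely many \<open>U n\<close> meet \<open>C\<close>, hence all but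
  finitely many \<open>\<phi> n\<close> vanish identically on \<open>B\<close>.

  It is not equicontinuous: otherwise the functions \<open>h n\<close> would be equicontinuous at \<open>z\<close>
  (\<open>equicontinuous_imp_uniformly_close\<close>). But \<open>h n z = 0\<close> for almost all \<open>n\<close>, because the compact
  set \<open>{z}\<close> meets only finitely many \<open>U n\<close>, whereas every neighbourhood of \<open>z\<close> contains points
  \<open>a n\<close>, where \<open>h n\<close> equals \<open>1\<close>, with such \<open>n\<close>.
\<close>

section \<open>Continuous functions on completely regular spaces\<close>

lemma completely_regular_bump:
  assumes "completely_regular_space X" "openin X W" "x \<in> W"
  shows "\<exists>g. continuous_map X euclideanreal g \<and> g x = 1 \<and>
    (\<forall>y\<in>topspace X. y \<notin> W \<longrightarrow> g y = 0)"
proof -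
  have "closedin X (topspace X - W)" "x \<in> topspace X - (topspace X - W)"
    using assms openin_subset by fastforce+
  then obtain f where f: "continuous_map X euclideanreal f" "f x = 0" "f ` (topspace X - W) \<subseteq> {1}"
    using assms(1) unfolding completely_regular_space_alt by blast
  have "continuous_map X euclideanreal (\<lambda>y. 1 - f y)"
    using f(1) by (intro continuous_intros) auto
  then show ?thesis
    using f(2,3) by (intro exI[of _ "\<lambda>y. 1 - f y"]) auto
qed

text \<open>
  The functions \<open>g k\<close> may be multiplied by arbitrarily large constants without destroying the
  continuity of their sum, since on each of the open sets \<open>{\<bar>f\<bar> < m}\<close>, which cover the space, the
  sum is finite. The upper summation bound is an integer beyond which all terms vanish at \<open>x\<close>.
\<close>

lemma continuous_map_escaping_sum:
  fixes f :: "'a \<Rightarrow> real" and g :: "nat \<Rightarrow> 'a \<Rightarrow> real"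
  assumes f: "continuous_map X euclideanreal f"
    and g: "\<And>k. continuous_map X euclideanreal (g k)"
    and g0: "\<And>k x. x \<in> topspace X \<Longrightarrow> \<bar>f x\<bar> \<le> real k \<Longrightarrow> g k x = 0"
  shows "continuous_map X euclideanreal (\<lambda>x. \<Sum>k<nat \<lceil>\<bar>f x\<bar>\<rceil>. g k x)"
proof -
  let ?T = "\<lambda>m. {x \<in> topspace X. \<bar>f x\<bar> \<in> {..<real m}}"
  have fin: "(\<Sum>k<nat \<lceil>\<bar>f x\<bar>\<rceil>. g k x) = (\<Sum>k<m. g k x)"
    if "x \<in> topspace X" "\<bar>f x\<bar> \<le> real m" for x m
  proof (rule sum.mono_neutral_left)
    show "{..<nat \<lceil>\<bar>f x\<bar>\<rceil>} \<subseteq> {..<m}"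
      using that(2) by (auto simp: nat_le_iff ceiling_le_iff intro: less_le_trans)
    show "\<forall>k\<in>{..<m} - {..<nat \<lceil>\<bar>f x\<bar>\<rceil>}. g k x = 0"
    proof
      fix k assume "k \<in> {..<m} - {..<nat \<lceil>\<bar>f x\<bar>\<rceil>}"
      then have "\<bar>f x\<bar> \<le> real k" by (simp add: nat_le_iff ceiling_le_iff)
      then show "g k x = 0" using g0 that(1) by blast
    qed
  qed simp
  have op: "openin X (?T m)" for m
  proof (rule openin_continuous_map_preimage)
    show "continuous_map X euclideanreal (\<lambda>x. \<bar>f x\<bar>)"
      using f by (rule continuous_map_real_abs)
  qed (simp add: open_lessThan)
  show ?thesis
  proof (rule pasting_lemma[where I = UNIV and T = ?T and f = "\<lambda>m x. \<Sum>k<m. g k x"])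
    show "continuous_map (subtopology X (?T m)) euclideanreal (\<lambda>x. \<Sum>k<m. g k x)" for m
      by (intro continuous_map_from_subtopology continuous_map_sum g) auto
    show "(\<Sum>k<m. g k x) = (\<Sum>k<n. g k x)"
      if "m \<in> UNIV" "n \<in> UNIV" "x \<in> topspace X \<inter> ?T m \<inter> ?T n" for m n x
      using that fin[of x m] fin[of x n] by auto
    show "\<exists>m. m \<in> UNIV \<and> x \<in> ?T m \<and> (\<Sum>k<nat \<lceil>\<bar>f x\<bar>\<rceil>. g k x) = (\<Sum>k<m. g k x)"
      if x: "x \<in> topspace X" for x
    proof -
      obtain m where "\<bar>f x\<bar> < real m" using reals_Archimedean2 by blast
      then show ?thesis using x fin[of x m] by (intro exI[of _ m]) auto
    qed
  qed (rule op)
qed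

section \<open>Triangular systems of linear equations\<close>

fun forward_substitution :: "(nat \<Rightarrow> nat \<Rightarrow> 'f::field) \<Rightarrow> (nat \<Rightarrow> 'f) \<Rightarrow> nat \<Rightarrow> 'f" where
  "forward_substitution t y n =
     (y n - (\<Sum>k<n. t n k * forward_substitution t y k)) / t n n"

declare forward_substitution.simps [simp del]

lemma forward_substitution_solves:
  assumes "t n n \<noteq> 0"
  shows "(\<Sum>k\<le>n. t n k * forward_substitution t y k) = y n"
proof -
  have "(\<Sum>k\<le>n. t n k * forward_substitution t y k) =
        (\<Sum>k<n. t n k * forward_substitution t y k) + t n n * forward_substitution t y n"
    by (simp add: lessThan_Suc_atMost[symmetric])
  then show ?thesis
    using assms by (subst (asm) (3) forward_substitution.simps) simp
qed

section \<open>Functionals on free locally convex spaces\<close>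

lemma lc_space_euclideanreal: "lc_space euclideanreal"
  unfolding lc_space_def
proof (intro conjI)
  have "continuous_on UNIV (\<lambda>(x, y). x + y :: real)" "continuous_on UNIV (\<lambda>(c, x). c *\<^sub>R x :: real)"
    by (auto simp: split_beta intro!: continuous_intros)
  then show "continuous_map (prod_topology euclideanreal euclideanreal) euclideanreal (\<lambda>(x, y). x + y)"
    "continuous_map (prod_topology euclideanreal euclideanreal) euclideanreal (\<lambda>(c, x). c *\<^sub>R x)"
    by simp_all
  show "neighbourhood_base_of convex euclideanreal"
    unfolding neighbourhood_base_of
  proof (intro allI impI)
    fix W and x :: real assume "openin euclidean W \<and> x \<in> W"
    then obtain e where "e > 0" "ball x e \<subseteq> W"
      by (auto simp: open_contains_ball)
    then show "\<exists>U V. openin euclidean U \<and> convex V \<and> x \<in> U \<and> U \<subseteq> V \<and> V \<subseteq> W"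
      by (intro exI[of _ "ball x e"]) auto
  qed
qed (auto simp: Hausdorff_space_euclidean)

lemma free_lc_space_functional_exists:
  assumes "free_lc_space X L i" "continuous_map X euclideanreal f"
  shows "\<exists>g\<in>lc_dual L. \<forall>x\<in>topspace X. g (i x) = f x"
  using free_lc_space_universal[OF assms(1) lc_space_euclideanreal] assms(2)
  unfolding lc_universal_for_def lc_dual_def by blast

lemma lc_operators_sum:
  assumes "subspace (topspace E)" "g \<in> lc_operators E F"
    and "finite T" "\<And>x. x \<in> T \<Longrightarrow> v x \<in> topspace E"
  shows "g (\<Sum>x\<in>T. u x *\<^sub>R v x) = (\<Sum>x\<in>T. u x *\<^sub>R g (v x))"
  using assms(3,4)
proof (induction T rule: finite_induct)
  case empty
  have "g (0 *\<^sub>R 0) = 0 *\<^sub>R g 0"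
    using assms(2) subspace_0[OF assms(1)] unfolding lc_operators_def by blast
  then show ?case by simp
next
  case (insert y T)
  have "(\<Sum>x\<in>T. u x *\<^sub>R v x) \<in> topspace E" "u y *\<^sub>R v y \<in> topspace E"
    using assms(1) insert by (auto intro: subspace_sum subspace_scale)
  moreover have "v y \<in> topspace E" using insert by simp
  ultimately show ?case using insert assms(2) by (simp add: lc_operators_def)
qed

lemma lc_bounded_imp_functional_bounded:
  assumes "lc_bounded E B" "g \<in> lc_dual E" "subspace (topspace E)"
  obtains r where "\<And>b. b \<in> B \<Longrightarrow> \<bar>g b\<bar> \<le> r"
proof -
  let ?V = "{v \<in> topspace E. g v \<in> {-1<..<1}}"
  have g: "continuous_map E euclideanreal g" "\<And>c v. v \<in> topspace E \<Longrightarrow> g (c *\<^sub>R v) = c * g v"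
    using assms(2) by (auto simp: lc_dual_def lc_operators_def)
  have "openin E ?V"
    by (rule openin_continuous_map_preimage[OF g(1)]) simp
  moreover have "0 \<in> ?V"
    using g(2)[of 0 0] subspace_0[OF assms(3)] by simp
  ultimately have "zero_nbhd E ?V"
    unfolding zero_nbhd_def by blast
  then obtain r where r: "r > 0" "\<And>c. \<bar>c\<bar> \<ge> r \<Longrightarrow> B \<subseteq> (\<lambda>x. c *\<^sub>R x) ` ?V"
    using assms(1) unfolding lc_bounded_def by meson
  have "\<bar>g b\<bar> \<le> r" if "b \<in> B" for b
  proof -
    have "b \<in> (\<lambda>x. r *\<^sub>R x) ` ?V"
      using r(2)[of r] r(1) that by auto
    then obtain v where "b = r *\<^sub>R v" "v \<in> ?V"
      by blast
    then have "g b = r * g v" "\<bar>g v\<bar> \<le> 1" using g(2) by auto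
    then show ?thesis using r(1) by (simp add: abs_mult mult_le_cancel_left1)
  qed
  then show thesis by (rule that)
qed

lemma span_image_representation:
  assumes "v \<in> span (i ` A)"
  shows "\<exists>T u. finite T \<and> T \<subseteq> A \<and> (\<forall>x\<in>T. u x \<noteq> 0) \<and> v = (\<Sum>x\<in>T. u x *\<^sub>R i x)"
proof -
  obtain S r where S: "finite S" "S \<subseteq> i ` A" and v: "v = (\<Sum>s\<in>S. r s *\<^sub>R s)"
    using assms unfolding span_explicit by blast
  obtain T where T: "finite T" "T \<subseteq> A" "S = i ` T" "inj_on i T"
    using S by (metis finite_subset_image inj_on_iff_eq_card subset_image_inj finite_image_iff)
  let ?T = "{x \<in> T. r (i x) \<noteq> 0}"
  have "v = (\<Sum>x\<in>T. r (i x) *\<^sub>R i x)"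
    unfolding v T(3) by (simp add: sum.reindex[OF T(4)])
  also have "\<dots> = (\<Sum>x\<in>?T. r (i x) *\<^sub>R i x)"
    using T(1) by (intro sum.mono_neutral_right) auto
  finally show ?thesis
    using T by (intro exI[of _ ?T] exI[of _ "\<lambda>x. r (i x)"]) auto
qed

section \<open>Supports of bounded sets\<close>

text \<open>
  A gliding hump argument, with the points occurring in some representation of \<open>b\<close> as its support
  \<open>T b\<close>. If a continuous \<open>f\<close> were unbounded on the union of these supports,
  one could choose elements \<open>b n\<close> of \<open>B\<close> and bumps \<open>g n\<close> that isolate a single point of the support
  of \<open>b n\<close> and live where \<open>\<bar>f\<bar>\<close> exceeds its values on the supports of all earlier elements. The
  matrix of pairings of the bumps with the \<open>b n\<close> is then triangular with nonzero diagonal, so some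
  combination of the bumps takes the value \<open>n\<close> at \<open>b n\<close>, for every \<open>n\<close>. Since the bumps
  escape to infinity along \<open>\<bar>f\<bar>\<close>, this combination is continuous and extends to a continuous functional
  that is unbounded on \<open>B\<close>.
\<close>

lemma functionally_bounded_support:
  fixes i :: "'a \<Rightarrow> 'v::real_vector"
  assumes X: "completely_regular_space X" "t1_space X" and free: "free_lc_space X L i"
    and B: "lc_bounded L B"
    and T: "\<And>b. b \<in> B \<Longrightarrow> finite (T b)" "\<And>b. b \<in> B \<Longrightarrow> T b \<subseteq> topspace X"
    and u: "\<And>b x. b \<in> B \<Longrightarrow> x \<in> T b \<Longrightarrow> u b x \<noteq> 0"
    and rep: "\<And>b. b \<in> B \<Longrightarrow> b = (\<Sum>x\<in>T b. u b x *\<^sub>R i x)"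
  shows "functionally_bounded_in X (\<Union>b\<in>B. T b)"
  unfolding functionally_bounded_in_def
proof (intro conjI allI impI)
  show "(\<Union>b\<in>B. T b) \<subseteq> topspace X" using T by blast
  fix f assume f: "continuous_map X euclideanreal f"
  show "bounded (f ` (\<Union>b\<in>B. T b))"
  proof (rule ccontr)
    assume unb: "\<not> bounded (f ` (\<Union>b\<in>B. T b))"
    have "\<exists>b x. b \<in> B \<and> x \<in> T b \<and> \<bar>f x\<bar> > real N" for N
    proof (rule ccontr)
      assume "\<nexists>b x. b \<in> B \<and> x \<in> T b \<and> \<bar>f x\<bar> > real N"
      then have "\<forall>y \<in> f ` (\<Union>b\<in>B. T b). norm y \<le> real N" by (auto simp: not_less)
      then show False using unb unfolding bounded_iff by blast
    qed
    then obtain \<beta> \<xi> where \<beta>: "\<And>N. \<beta> N \<in> B" and \<xi>: "\<And>N. \<xi> N \<in> T (\<beta> N)" "\<And>N. \<bar>f (\<xi> N)\<bar> > real N"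
      by metis
    have "\<exists>m::nat. \<forall>x\<in>T (\<beta> N). \<bar>f x\<bar> \<le> real m" for N
    proof -
      have "finite ((\<lambda>x. \<bar>f x\<bar>) ` T (\<beta> N))" using T(1)[OF \<beta>] by simp
      then obtain r where "\<forall>x\<in>T (\<beta> N). \<bar>f x\<bar> \<le> r"
        by (metis bdd_above_finite bdd_above_def image_eqI)
      moreover obtain m where "r \<le> real m" using real_arch_simple by blast
      ultimately show ?thesis by (meson order_trans)
    qed
    then obtain M where M: "\<And>N x. x \<in> T (\<beta> N) \<Longrightarrow> \<bar>f x\<bar> \<le> real (M N)" by metis
    \<comment> \<open>The \<open>n\<close>-th hump lives on \<open>{\<bar>f\<bar> > N n}\<close>, and \<open>N (Suc n)\<close> dominates \<open>\<bar>f\<bar>\<close> on the support of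
      the \<open>n\<close>-th element of \<open>B\<close>.\<close>
    define N where "N n = (M ^^ n) 0" for n
    have N_Suc: "N (Suc n) = M (N n)" for n by (simp add: N_def)
    have "N n < N (Suc n)" for n
      using \<xi>(2)[of "N n"] M[OF \<xi>(1), of "N n"] by (simp add: N_Suc)
    then have N: "strict_mono N" by (simp add: strict_mono_Suc_iff)
    define b where "b n = \<beta> (N n)" for n
    define p where "p n = \<xi> (N n)" for n
    have b: "b n \<in> B" and p: "p n \<in> T (b n)" "\<bar>f (p n)\<bar> > real (N n)" for n
      using \<beta> \<xi> by (auto simp: b_def p_def)
    have "\<exists>g. continuous_map X euclideanreal g \<and> g (p n) = 1 \<and>
        (\<forall>x\<in>topspace X. \<bar>f x\<bar> \<le> real (N n) \<or> x \<in> T (b n) - {p n} \<longrightarrow> g x = 0)" for n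
    proof -
      let ?W = "{x \<in> topspace X. \<bar>f x\<bar> \<in> {real (N n)<..}} - (T (b n) - {p n})"
      have "openin X {x \<in> topspace X. \<bar>f x\<bar> \<in> {real (N n)<..}}"
        by (rule openin_continuous_map_preimage[OF continuous_map_real_abs[OF f]]) simp
      moreover have "closedin X (T (b n) - {p n})"
        using X(2) T[OF b[of n]] by (metis Diff_subset finite_Diff subset_trans t1_space_closedin_finite)
      ultimately have "openin X ?W" by (rule openin_diff)
      moreover have "p n \<in> ?W" using p T(2)[OF b] by auto
      ultimately obtain g where g: "continuous_map X euclideanreal g" "g (p n) = 1"
          "\<forall>y\<in>topspace X. y \<notin> ?W \<longrightarrow> g y = 0"
        using completely_regular_bump[OF X(1), of ?W "p n"] by blast
      have "g x = 0" if "x \<in> topspace X" "\<bar>f x\<bar> \<le> real (N n) \<or> x \<in> T (b n) - {p n}" for x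
      proof -
        have "x \<notin> ?W" using that(2) by force
        then show ?thesis using g(3) that(1) by blast
      qed
      then show ?thesis using g(1,2) by blast
    qed
    then obtain g where g: "\<And>n. continuous_map X euclideanreal (g n)" "\<And>n. g n (p n) = (1::real)"
        "\<And>n x. x \<in> topspace X \<Longrightarrow> \<bar>f x\<bar> \<le> real (N n) \<or> x \<in> T (b n) - {p n} \<Longrightarrow> g n x = 0"
      by metis
    define t where "t n k = (\<Sum>x\<in>T (b n). u (b n) x * g k x)" for n k
    have "t n n = u (b n) (p n)" for n
    proof -
      have "t n n = (\<Sum>x\<in>{p n}. u (b n) x * g n x)"
        unfolding t_def
      proof (rule sum.mono_neutral_right)
        have "g n x = 0" if "x \<in> T (b n) - {p n}" for x
          using g(3)[of x n] that T(2)[OF b[of n]] by blast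
        then show "\<forall>x\<in>T (b n) - {p n}. u (b n) x * g n x = 0" by simp
      qed (use T(1)[OF b] p(1) in auto)
      then show ?thesis using g(2) by simp
    qed
    then have diag: "t n n \<noteq> 0" for n using u[OF b p(1)] by simp
    define c where "c = forward_substitution t real"
    have c: "(\<Sum>k\<le>n. t n k * c k) = real n" for n
      unfolding c_def by (rule forward_substitution_solves[OF diag])
    define h where "h x = (\<Sum>k<nat \<lceil>\<bar>f x\<bar>\<rceil>. c k * g k x)" for x
    have g0: "c k * g k x = 0" if "x \<in> topspace X" "\<bar>f x\<bar> \<le> real k" for k x
    proof -
      have "k \<le> N k" using N by (rule strict_mono_imp_increasing)
      then show ?thesis using g(3)[of x k] that by simp
    qed
    have "continuous_map X euclideanreal (\<lambda>x. c k * g k x)" for k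
      by (intro continuous_map_real_mult_left g)
    then have "continuous_map X euclideanreal h"
      unfolding h_def using continuous_map_escaping_sum[OF f, of "\<lambda>k x. c k * g k x"] g0 by blast
    then obtain H where H: "H \<in> lc_dual L" "\<And>x. x \<in> topspace X \<Longrightarrow> H (i x) = h x"
      using free_lc_space_functional_exists[OF free] by blast
    have L: "subspace (topspace L)" and i: "\<And>x. x \<in> topspace X \<Longrightarrow> i x \<in> topspace L"
      using free by (auto simp: free_lc_space_def lc_space_def continuous_map_def)
    have "H (b n) = real n" for n
    proof -
      have hx: "h x = (\<Sum>k\<le>n. c k * g k x)" if "x \<in> T (b n)" for x
      proof -
        have x: "x \<in> topspace X" "\<bar>f x\<bar> \<le> real (N (Suc n))"
          using that T(2)[OF b] M by (auto simp: N_Suc b_def)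
        \<comment> \<open>Humps after the \<open>n\<close>-th vanish at \<open>x\<close>, and so do those with index at least \<open>\<bar>f x\<bar>\<close>.\<close>
        have late: "g k x = 0" if "n < k" for k
        proof -
          have "N (Suc n) \<le> N k" using N that by (simp add: strict_mono_less_eq)
          then show ?thesis using x g(3)[of x k] by simp
        qed
        have "h x = (\<Sum>k<max (Suc n) (nat \<lceil>\<bar>f x\<bar>\<rceil>). c k * g k x)"
          unfolding h_def
        proof (rule sum.mono_neutral_left, goal_cases)
          case 3
          have "c k * g k x = 0" if "\<not> k < nat \<lceil>\<bar>f x\<bar>\<rceil>" for k
            using g0[OF x(1), of k] that by (simp add: not_less nat_le_iff ceiling_le_iff)
          then show ?case by blast
        qed auto
        also have "\<dots> = (\<Sum>k\<le>n. c k * g k x)"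
          using late by (intro sum.mono_neutral_right) auto
        finally show ?thesis .
      qed
      have "H (b n) = H (\<Sum>x\<in>T (b n). u (b n) x *\<^sub>R i x)"
        by (rule arg_cong[OF rep[OF b]])
      also have "\<dots> = (\<Sum>x\<in>T (b n). u (b n) x *\<^sub>R H (i x))"
        using H(1) T[OF b] i unfolding lc_dual_def by (intro lc_operators_sum[OF L]) auto
      also have "\<dots> = (\<Sum>x\<in>T (b n). \<Sum>k\<le>n. u (b n) x * (c k * g k x))"
        using T(2)[OF b[of n]]
        by (intro sum.cong refl) (auto simp: H(2) hx sum_distrib_left subset_iff)
      also have "\<dots> = (\<Sum>k\<le>n. \<Sum>x\<in>T (b n). u (b n) x * (c k * g k x))"
        by (rule sum.swap)
      also have "\<dots> = (\<Sum>k\<le>n. t n k * c k)"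
        by (simp add: t_def sum_distrib_left mult_ac)
      finally show ?thesis using c by simp
    qed
    moreover obtain r where "\<And>v. v \<in> B \<Longrightarrow> \<bar>H v\<bar> \<le> r"
      using lc_bounded_imp_functional_bounded[OF B H(1) L] by blast
    ultimately have "real n \<le> r" for n using b by (metis abs_of_nat)
    then show False using reals_Archimedean2 not_less by blast
  qed
qed

section \<open>Strongly null and equicontinuous sequences\<close>

text \<open>
  In a \<open>\<mu>\<close>-space, the support of a bounded set lies in a compact set. Almost all \<open>U n\<close> miss that
  set, so almost all \<open>\<phi> n\<close> vanish on the bounded set, which is more than uniform convergence.
\<close>

lemma strongly_null_if_compact_finite:
  fixes i :: "'a \<Rightarrow> 'v::real_vector" and \<phi> :: "nat \<Rightarrow> 'v \<Rightarrow> real"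
  assumes X: "completely_regular_space X" "t1_space X" "mu_space X" and free: "free_lc_space X L i"
    and fin: "\<And>C. compactin X C \<Longrightarrow> finite {n. C \<inter> U n \<noteq> {}}"
    and \<phi>: "\<And>n. \<phi> n \<in> lc_dual L"
    and \<phi>0: "\<And>n x. x \<in> topspace X \<Longrightarrow> x \<notin> U n \<Longrightarrow> \<phi> n (i x) = 0"
  shows "limitin (strong_dual L) \<phi> (\<lambda>x\<in>topspace L. 0) sequentially"
  unfolding limitin_def topspace_strong_dual
proof (intro conjI allI impI)
  have L: "subspace (topspace L)" and i: "\<And>x. x \<in> topspace X \<Longrightarrow> i x \<in> topspace L"
    using free by (auto simp: free_lc_space_def lc_space_def continuous_map_def)
  have "continuous_map L euclideanreal (\<lambda>x\<in>topspace L. 0)"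
    by (rule continuous_map_eq[of _ _ "\<lambda>x. 0"]) auto
  then show "(\<lambda>x\<in>topspace L. 0) \<in> lc_dual L"
    using L by (auto simp: lc_dual_def lc_operators_def subspace_add subspace_scale)
  fix W assume W: "openin (strong_dual L) W \<and> (\<lambda>x\<in>topspace L. 0) \<in> W"
  then obtain B \<epsilon> where B: "lc_bounded L B" "\<epsilon> > 0"
      "{\<psi> \<in> lc_dual L. \<forall>x\<in>B. \<bar>\<psi> x - (\<lambda>x\<in>topspace L. 0) x\<bar> < \<epsilon>} \<subseteq> W"
    unfolding openin_strong_dual by blast
  have BL: "B \<subseteq> topspace L" using B(1) by (simp add: lc_bounded_def)
  have "\<forall>b\<in>B. \<exists>T u. finite T \<and> T \<subseteq> topspace X \<and> (\<forall>x\<in>T. u x \<noteq> 0) \<and> b = (\<Sum>x\<in>T. u x *\<^sub>R i x)"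
  proof
    fix b assume "b \<in> B"
    then have "b \<in> span (i ` topspace X)"
      using BL free_lc_space_span[OF free] by blast
    then show "\<exists>T u. finite T \<and> T \<subseteq> topspace X \<and> (\<forall>x\<in>T. u x \<noteq> 0) \<and> b = (\<Sum>x\<in>T. u x *\<^sub>R i x)"
      by (rule span_image_representation)
  qed
  then obtain T u where Tu: "\<forall>b\<in>B. finite (T b) \<and> T b \<subseteq> topspace X \<and>
      (\<forall>x\<in>T b. u b x \<noteq> (0::real)) \<and> b = (\<Sum>x\<in>T b. u b x *\<^sub>R i x)"
    unfolding bchoice_iff by blast
  then have T: "\<And>b. b \<in> B \<Longrightarrow> finite (T b)" "\<And>b. b \<in> B \<Longrightarrow> T b \<subseteq> topspace X"
    and u: "\<And>b x. b \<in> B \<Longrightarrow> x \<in> T b \<Longrightarrow> u b x \<noteq> 0"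
    and rep: "\<And>b. b \<in> B \<Longrightarrow> b = (\<Sum>x\<in>T b. u b x *\<^sub>R i x)"
    by blast+
  let ?S = "\<Union>b\<in>B. T b"
  have "functionally_bounded_in X ?S"
    by (rule functionally_bounded_support[OF X(1,2) free B(1) T u rep])
  then have "compactin X (X closure_of ?S)" "?S \<subseteq> X closure_of ?S"
    using X(3) closure_of_subset[of ?S X] by (simp_all add: mu_space_def functionally_bounded_in_def)
  then have "finite {n. ?S \<inter> U n \<noteq> {}}"
    using fin[of "X closure_of ?S"] by (auto elim!: rev_finite_subset)
  then have "\<forall>\<^sub>F n in sequentially. ?S \<inter> U n = {}"
    by (simp add: eventually_cofinite flip: cofinite_eq_sequentially)
  then show "\<forall>\<^sub>F n in sequentially. \<phi> n \<in> W"
  proof eventually_elim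
    case (elim n)
    have "\<phi> n b = 0" if b: "b \<in> B" for b
    proof -
      have "\<phi> n b = \<phi> n (\<Sum>x\<in>T b. u b x *\<^sub>R i x)" by (rule arg_cong[OF rep[OF b]])
      also have "\<dots> = (\<Sum>x\<in>T b. u b x *\<^sub>R \<phi> n (i x))"
        using \<phi> T[OF b] i unfolding lc_dual_def by (intro lc_operators_sum[OF L]) auto
      also have "\<dots> = 0"
        using elim b T(2)[OF b] by (intro sum.neutral) (auto intro!: \<phi>0)
      finally show ?thesis .
    qed
    then have "\<phi> n \<in> {\<psi> \<in> lc_dual L. \<forall>x\<in>B. \<bar>\<psi> x - (\<lambda>x\<in>topspace L. 0) x\<bar> < \<epsilon>}"
      using \<phi> B(2) BL by auto
    then show ?case using B(3) by blast
  qed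
qed

text \<open>
  If \<open>H\<close> lies in the polar of a neighbourhood \<open>N\<close> of zero, then the required neighbourhood of \<open>z\<close>
  is the preimage under the continuous map \<open>x \<mapsto> (i x - i z) / e\<close> of an open set inside \<open>N\<close>.
\<close>

lemma equicontinuous_imp_uniformly_close:
  fixes i :: "'a \<Rightarrow> 'v::real_vector"
  assumes L: "lc_space L" and i: "continuous_map X L i" and z: "z \<in> topspace X"
    and H: "equicontinuous L H" and e: "e > 0"
  obtains W where "openin X W" "z \<in> W"
    "\<And>x \<phi>. x \<in> W \<Longrightarrow> \<phi> \<in> H \<Longrightarrow> \<bar>\<phi> (i x) - \<phi> (i z)\<bar> \<le> e"
proof -
  obtain N V where V: "openin L V" "0 \<in> V" "V \<subseteq> N" and N: "H \<subseteq> polar L N"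
    using H unfolding equicontinuous_def zero_nbhd_def by blast
  have le1: "\<bar>\<phi> v\<bar> \<le> 1" if "\<phi> \<in> H" "v \<in> V" for \<phi> v
    using that V(3) N by (auto simp: polar_def)
  have dual: "\<phi> \<in> lc_dual L" if "\<phi> \<in> H" for \<phi>
    using that N by (auto simp: polar_def)
  have sub: "subspace (topspace L)"
    and plus: "continuous_map (prod_topology L L) L (\<lambda>(x, y). x + y)"
    and scale: "continuous_map (prod_topology euclideanreal L) L (\<lambda>(c, x). c *\<^sub>R x)"
    using L by (auto simp: lc_space_def)
  have iL: "i x \<in> topspace L" if "x \<in> topspace X" for x
    using i that by (auto simp: continuous_map_def)
  have mz: "(-1) *\<^sub>R i z \<in> topspace L" using sub iL[OF z] by (rule subspace_scale)
  let ?d = "\<lambda>x. i x + (-1) *\<^sub>R i z"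
  have d: "?d x \<in> topspace L" if "x \<in> topspace X" for x
    using sub iL[OF that] mz by (rule subspace_add)
  have "continuous_map X (prod_topology L L) (\<lambda>x. (i x, (-1) *\<^sub>R i z))"
    using i mz by (simp add: continuous_map_pairedI)
  from continuous_map_compose[OF this plus]
  have "continuous_map X L ?d" by (simp add: o_def)
  then have "continuous_map X (prod_topology euclideanreal L) (\<lambda>x. (1 / e, ?d x))"
    by (simp add: continuous_map_pairedI)
  from continuous_map_compose[OF this scale]
  have cont: "continuous_map X L (\<lambda>x. (1 / e) *\<^sub>R ?d x)" by (simp add: o_def)
  show thesis
  proof (rule that[of "{x \<in> topspace X. (1 / e) *\<^sub>R ?d x \<in> V}"])
    show "openin X {x \<in> topspace X. (1 / e) *\<^sub>R ?d x \<in> V}"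
      by (rule openin_continuous_map_preimage[OF cont V(1)])
    show "z \<in> {x \<in> topspace X. (1 / e) *\<^sub>R ?d x \<in> V}" using z V(2) by simp
    fix x \<phi> assume x: "x \<in> {x \<in> topspace X. (1 / e) *\<^sub>R ?d x \<in> V}" and \<phi>: "\<phi> \<in> H"
    have add: "\<phi> (v + w) = \<phi> v + \<phi> w" and sc: "\<phi> (r *\<^sub>R v) = r * \<phi> v"
      if "v \<in> topspace L" "w \<in> topspace L" for v w r
      using dual[OF \<phi>] that by (auto simp: lc_dual_def lc_operators_def)
    have xX: "x \<in> topspace X" using x by simp
    have "\<phi> ((1 / e) *\<^sub>R ?d x) = (1 / e) * (\<phi> (i x) + (-1) * \<phi> (i z))"
      by (simp only: sc[OF d[OF xX] mz] add[OF iL[OF xX] mz] sc[OF iL[OF z] mz])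
    moreover have "\<bar>\<phi> ((1 / e) *\<^sub>R ?d x)\<bar> \<le> 1"
      using le1[OF \<phi>] x by blast
    ultimately have "\<bar>(1 / e) * (\<phi> (i x) - \<phi> (i z))\<bar> \<le> 1"
      by simp
    then show "\<bar>\<phi> (i x) - \<phi> (i z)\<bar> \<le> e"
      using e by (simp add: abs_mult field_simps)
  qed
qed

theorem proposition3p4:
  fixes X :: "'a topology" and L :: "'v::real_vector topology" and i :: "'a \<Rightarrow> 'v"
    and U :: "nat \<Rightarrow> 'a set" and a :: "nat \<Rightarrow> 'a" and z :: 'a
  assumes "tychonoff_space X"
    and "mu_space X"
    and "\<forall>n. openin X (U n)"
    and "\<forall>n. a n \<in> U n"
    and "\<forall>C. compactin X C \<longrightarrow> finite {n. C \<inter> U n \<noteq> {}}"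
    and "z \<in> X derived_set_of (range a)"
    and "free_lc_space X L i"
  shows "\<not> c0_quasibarrelled L"
proof
  assume c0: "c0_quasibarrelled L"
  have X: "completely_regular_space X" "t1_space X"
    using assms(1) Hausdorff_imp_t1_space by (auto simp: tychonoff_space_def)
  have L: "lc_space L" "continuous_map X L i"
    using assms(7) by (auto simp: free_lc_space_def)
  have z: "z \<in> topspace X"
    and cluster: "\<And>W. z \<in> W \<Longrightarrow> openin X W \<Longrightarrow> \<exists>y. y \<noteq> z \<and> y \<in> range a \<and> y \<in> W"
    using assms(6) by (auto simp: in_derived_set_of)
  have aX: "a n \<in> topspace X" for n
    using assms(3,4) openin_subset by blast
  have "\<exists>h. continuous_map X euclideanreal h \<and> h (a n) = 1 \<and>
      (\<forall>y\<in>topspace X. y \<notin> U n \<longrightarrow> h y = 0)" for n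
    using completely_regular_bump[OF X(1)] assms(3,4) by simp
  then obtain h where h: "\<And>n. continuous_map X euclideanreal (h n)" "\<And>n. h n (a n) = (1::real)"
      "\<And>n y. y \<in> topspace X \<Longrightarrow> y \<notin> U n \<Longrightarrow> h n y = 0"
    by metis
  have "\<exists>g. g \<in> lc_dual L \<and> (\<forall>x\<in>topspace X. g (i x) = h n x)" for n
    using free_lc_space_functional_exists[OF assms(7) h(1)] by blast
  then obtain \<phi> where \<phi>: "\<And>n. \<phi> n \<in> lc_dual L" "\<And>n x. x \<in> topspace X \<Longrightarrow> \<phi> n (i x) = h n x"
    by metis
  have "limitin (strong_dual L) \<phi> (\<lambda>x\<in>topspace L. 0) sequentially"
    using strongly_null_if_compact_finite[OF X assms(2,7), of U \<phi>] assms(5) \<phi> h(3) by auto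
  then have "equicontinuous L (range \<phi>)"
    using c0 \<phi>(1) unfolding c0_quasibarrelled_def by blast
  then obtain W where W: "openin X W" "z \<in> W"
      "\<And>x \<psi>. x \<in> W \<Longrightarrow> \<psi> \<in> range \<phi> \<Longrightarrow> \<bar>\<psi> (i x) - \<psi> (i z)\<bar> \<le> 1 / 2"
    using equicontinuous_imp_uniformly_close[OF L z, of "range \<phi>" "1 / 2"] by auto
  let ?F = "{n. {z} \<inter> U n \<noteq> {}}"
  have "finite ?F" using assms(5) z by (metis compactin_sing)
  then have "closedin X (a ` ?F - {z})"
    using aX by (intro t1_space_closedin_finite[THEN iffD1, OF X(2), rule_format]) auto
  \<comment> \<open>Only the finitely many \<open>h n\<close> with \<open>n\<close> in \<open>?F\<close> can be nonzero at \<open>z\<close>. Removing the corresponding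
    \<open>a n\<close> from \<open>W\<close>, except \<open>z\<close> itself, leaves a neighbourhood of \<open>z\<close> and so forces the cluster
    property to produce an index outside \<open>?F\<close>.\<close>
  then have "openin X (W - (a ` ?F - {z}))" using W(1) by (simp add: openin_diff)
  then obtain m where m: "a m \<noteq> z" "a m \<in> W - (a ` ?F - {z})"
    using cluster[of "W - (a ` ?F - {z})"] W(2) by blast
  then have "z \<notin> U m" by blast
  then have "\<phi> m (i z) = 0" "\<phi> m (i (a m)) = 1"
    using \<phi>(2) h(2,3) z aX by auto
  then show False using W(3)[of "a m" "\<phi> m"] m(2) by simp
qed

end
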